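(* Let $\mathbb{F}_q$ be any finite field, and let $M=(E,I)$ be any non-free, $\mathbb{F}_q$-representable matroid, of rank $r(M)$. If $m:\mathbb{N}\to\mathbb{N}$ satisfies (i) $m(n)\geq r(M)$ for all sufficiently large $n$, and (ii) $n-m(n)\to\infty$ as $n\to\infty$, then $$\lim_{n\to\infty}\mathbb{P}_{A_n\sim[U_q]^{m(n)\times n}}\{M \text{ is a minor of } M[A_n]\}=1.$$
   Context: $\mathbb{F}_q$ is the finite field with $q$ elements. $[U_q]^{m\times n}$ denotes the uniform distribution on $\mathbb{F}_q^{m\times n}$ (entries i.i.d. uniform on $\mathbb{F}_q$), and $A \sim [U_q]^{m \times n}$ means that $A$ is drawn from it. For a matrix $A$ over $\mathbb{F}_q$ with $n$ columns, $M[A]$ is the column dependence matroid of $A$: its ground set is the set of column indices $\{1,\dots,n\}$, and a set of indices is independent iff the corresponding columns form a linearly independent family. All matroids are finite; $M=(E,I)$ has ground set $E$ and collection of independent sets $I$. A matroid is $\mathbb{F}_q$-representable if it is isomorphic to $M[A]$ for some matrix $A$ over $\mathbb{F}_q$. A matroid is free if every subset of its ground set is independent, and non-free otherwise. "$M$ is a minor of $N$" means that $M$ is isomorphic to a matroid obtained from $N$ by a sequence of deletions and contractions. *)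

theory Defs
  imports
    "HOL-Probability.Probability_Mass_Function"
    "Jordan_Normal_Form.VS_Connect"
begin

section \<open>Finite matroids\<close>

text \<open>A set system \<open>(E, I)\<close>: ground set and collection of independent sets.\<close>

type_synonym 'a set_system = "'a set \<times> 'a set set"

abbreviation ground :: "'a set_system \<Rightarrow> 'a set" where
  "ground M \<equiv> fst M"

abbreviation indeps :: "'a set_system \<Rightarrow> 'a set set" where
  "indeps M \<equiv> snd M"

definition matroid :: "'a set_system \<Rightarrow> bool" where
  "matroid M \<longleftrightarrow>
     finite (ground M) \<and>
     indeps M \<subseteq> Pow (ground M) \<and>
     {} \<in> indeps M \<and>
     (\<forall>X\<in>indeps M. \<forall>Y. Y \<subseteq> X \<longrightarrow> Y \<in> indeps M) \<and>
     (\<forall>X\<in>indeps M. \<forall>Y\<in>indeps M. card X < card Y \<longrightarrow> (\<exists>y\<in>Y - X. insert y X \<in> indeps M))"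

definition matroid_rank :: "'a set_system \<Rightarrow> nat" where
  "matroid_rank M = Max (card ` indeps M)"

definition free_matroid :: "'a set_system \<Rightarrow> bool" where
  "free_matroid M \<longleftrightarrow> (\<forall>X. X \<subseteq> ground M \<longrightarrow> X \<in> indeps M)"

definition matroid_iso :: "'a set_system \<Rightarrow> 'b set_system \<Rightarrow> bool" where
  "matroid_iso M N \<longleftrightarrow>
     (\<exists>f. bij_betw f (ground M) (ground N) \<and>
          (\<forall>X. X \<subseteq> ground M \<longrightarrow> (X \<in> indeps M \<longleftrightarrow> f ` X \<in> indeps N)))"

section \<open>Minors\<close>

definition basis_of :: "'a set_system \<Rightarrow> 'a set \<Rightarrow> 'a set \<Rightarrow> bool" where
  "basis_of M T B \<longleftrightarrow>
     B \<subseteq> T \<and> B \<in> indeps M \<and> (\<forall>C. C \<subseteq> T \<and> C \<in> indeps M \<and> B \<subseteq> C \<longrightarrow> C = B)"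

definition deletion :: "'a set_system \<Rightarrow> 'a set \<Rightarrow> 'a set_system" where
  "deletion M T = (ground M - T, {X. X \<subseteq> ground M - T \<and> X \<in> indeps M})"

text \<open>
  In a matroid, whether \<open>X \<union> B\<close> is independent does not depend on the choice of
  the maximal independent subset \<open>B\<close> of \<open>T\<close>.
\<close>

definition contraction :: "'a set_system \<Rightarrow> 'a set \<Rightarrow> 'a set_system" where
  "contraction M T =
     (ground M - T, {X. X \<subseteq> ground M - T \<and> (\<exists>B. basis_of M T B \<and> X \<union> B \<in> indeps M)})"

inductive reduces_to :: "'a set_system \<Rightarrow> 'a set_system \<Rightarrow> bool" for N where
  start: "reduces_to N N"
| delete: "reduces_to N M \<Longrightarrow> T \<subseteq> ground M \<Longrightarrow> reduces_to N (deletion M T)"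
| contract: "reduces_to N M \<Longrightarrow> T \<subseteq> ground M \<Longrightarrow> reduces_to N (contraction M T)"

definition is_minor_of :: "'a set_system \<Rightarrow> 'b set_system \<Rightarrow> bool" where
  "is_minor_of M N \<longleftrightarrow> (\<exists>M'. reduces_to N M' \<and> matroid_iso M M')"

section \<open>Column dependence matroids\<close>

text \<open>
  Columns are numbered from \<open>0\<close>, as in the matrix library. The library's linear
  independence concerns sets of vectors; injectivity of \<open>col A\<close> on \<open>S\<close> turns it into
  linear independence of the family of columns indexed by \<open>S\<close>, so that repeated
  columns are dependent.
\<close>

definition column_matroid :: "'q::field mat \<Rightarrow> nat set_system" where
  "column_matroid A =
     ({0..<dim_col A},
      {S. S \<subseteq> {0..<dim_col A} \<and> inj_on (col A) S \<and>
          \<not> module.lin_dep class_ring (module_vec TYPE('q) (dim_row A)) (col A ` S)})"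

definition representable :: "'q::field itself \<Rightarrow> 'a set_system \<Rightarrow> bool" where
  "representable _ M \<longleftrightarrow> (\<exists>A::'q mat. matroid_iso M (column_matroid A))"

section \<open>Uniform random matrices\<close>

definition uniform_mat :: "nat \<Rightarrow> nat \<Rightarrow> 'q::{field,finite} mat pmf" where
  "uniform_mat m n = pmf_of_set (carrier_mat m n)"

text \<open>\<open>pmf_of_set\<close> is meaningful only for finite nonempty sets.\<close>

lemma finite_carrier_mat: "finite (carrier_mat m n :: 'q::finite mat set)"
proof -
  let ?F = "({..<m} \<times> {..<n}) \<rightarrow>\<^sub>E (UNIV :: 'q set)"
  have "carrier_mat m n \<subseteq> mat m n ` ?F"
  proof
    fix A :: "'q mat" assume A: "A \<in> carrier_mat m n"
    let ?f = "restrict (\<lambda>p. A $$ p) ({..<m} \<times> {..<n})"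
    have "A = mat m n ?f"
      using A by (intro eq_matI) auto
    moreover have "?f \<in> ?F"
      by auto
    ultimately show "A \<in> mat m n ` ?F"
      by (rule image_eqI[of A "mat m n" ?f])
  qed
  then show ?thesis
    by (rule finite_subset) (intro finite_imageI finite_PiE; simp)
qed

lemma carrier_mat_nonempty: "carrier_mat m n \<noteq> {}"
  by (metis empty_iff mat_carrier)

lemma pmf_uniform_mat:
  fixes A :: "'q::{field,finite} mat"
  assumes "A \<in> carrier_mat m n"
  shows "pmf (uniform_mat m n) A = 1 / real (card (carrier_mat m n :: 'q mat set))"
  using assms by (simp add: uniform_mat_def pmf_of_set finite_carrier_mat carrier_mat_nonempty)

end

theory Submission
  imports Defs
begin

text \<open>
  Contracting \<open>m - r\<close> independent columns of an \<open>m \<times> n\<close> matrix replaces every other column by its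
  residue in a quotient space of dimension \<open>r = r(M)\<close>, and the residue of a uniformly random column
  is uniform there. A union bound over the nonzero row vectors shows that slightly more than \<open>m\<close>
  random columns span with high probability, so the contracted columns can be chosen among an
  initial segment, leaving a number of independent columns that tends to infinity. Their residues
  then contain all columns of an \<open>r\<close>-row representation of \<open>M\<close>, with multiplicities, with
  probability tending to 1.
\<close>

section \<open>Linearly independent families\<close>

text \<open>Independence is stated for families, so repeated columns are dependent without a
  separate injectivity clause. Vectors are functions on a set \<open>I\<close> of rows, so dropping
  or renaming coordinates only changes \<open>I\<close>.\<close>

definition indep_fam :: "'i set \<Rightarrow> ('j \<Rightarrow> 'i \<Rightarrow> 'q::field) \<Rightarrow> 'j set \<Rightarrow> bool" where
  "indep_fam I x X \<longleftrightarrow>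
     (\<forall>c. (\<forall>i\<in>I. (\<Sum>j\<in>X. c j * x j i) = 0) \<longrightarrow> (\<forall>j\<in>X. c j = 0))"

lemma indep_famD:
  "indep_fam I x X \<Longrightarrow> (\<And>i. i \<in> I \<Longrightarrow> (\<Sum>j\<in>X. c j * x j i) = 0) \<Longrightarrow> j \<in> X \<Longrightarrow> c j = 0"
  unfolding indep_fam_def by blast

lemma indep_fam_mono:
  assumes "indep_fam I x X" "Y \<subseteq> X" "finite X"
  shows "indep_fam I x Y"
  unfolding indep_fam_def
proof (intro allI impI ballI)
  fix c j assume c: "\<forall>i\<in>I. (\<Sum>j\<in>Y. c j * x j i) = 0" and j: "j \<in> Y"
  let ?d = "\<lambda>j. if j \<in> Y then c j else 0"
  have "(\<Sum>j\<in>X. ?d j * x j i) = 0" if "i \<in> I" for i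
  proof -
    have "(\<Sum>j\<in>X. ?d j * x j i) = (\<Sum>j\<in>Y. c j * x j i)"
      using assms by (intro sum.mono_neutral_cong_right) auto
    then show ?thesis using c that by simp
  qed
  from indep_famD[OF assms(1) this, of j] j assms(2) show "c j = 0" by auto
qed

lemma indep_fam_cong:
  assumes "\<And>i j. i \<in> I \<Longrightarrow> j \<in> X \<Longrightarrow> x j i = y j i"
  shows "indep_fam I x X \<longleftrightarrow> indep_fam I y X"
  unfolding indep_fam_def using assms by simp

lemma indep_fam_image_cols:
  assumes "inj_on h X"
  shows "indep_fam I x (h ` X) \<longleftrightarrow> indep_fam I (\<lambda>j. x (h j)) X"
proof
  assume L: "indep_fam I x (h ` X)"
  show "indep_fam I (\<lambda>j. x (h j)) X"
    unfolding indep_fam_def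
  proof (intro allI impI ballI)
    fix c j assume c: "\<forall>i\<in>I. (\<Sum>j\<in>X. c j * x (h j) i) = 0" and j: "j \<in> X"
    let ?d = "\<lambda>k. c (the_inv_into X h k)"
    have "(\<Sum>k\<in>h ` X. ?d k * x k i) = 0" if "i \<in> I" for i
      using c that assms by (simp add: sum.reindex the_inv_into_f_f)
    from indep_famD[OF L this, of "h j"] j assms show "c j = 0"
      by (simp add: the_inv_into_f_f)
  qed
next
  assume R: "indep_fam I (\<lambda>j. x (h j)) X"
  show "indep_fam I x (h ` X)"
    unfolding indep_fam_def
  proof (intro allI impI ballI)
    fix c k assume c: "\<forall>i\<in>I. (\<Sum>j\<in>h ` X. c j * x j i) = 0" and k: "k \<in> h ` X"
    have "(\<Sum>j\<in>X. c (h j) * x (h j) i) = 0" if "i \<in> I" for i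
      using c that assms by (simp add: sum.reindex)
    from indep_famD[OF R this] k show "c k = 0" by auto
  qed
qed

lemma indep_fam_vec_iff:
  fixes f :: "'j \<Rightarrow> 'q::field vec"
  assumes f: "f ` X \<subseteq> carrier_vec m" and fin: "finite X"
  shows "inj_on f X \<and> \<not> module.lin_dep class_ring (module_vec TYPE('q) m) (f ` X)
     \<longleftrightarrow> indep_fam {..<m} (\<lambda>j i. f j $ i) X"
proof -
  interpret V: vec_space "TYPE('q)" m .
  show ?thesis
  proof (intro iffI conjI)
    assume L: "inj_on f X \<and> \<not> V.lin_dep (f ` X)"
    show "indep_fam {..<m} (\<lambda>j i. f j $ i) X"
      unfolding indep_fam_def
    proof (intro allI impI ballI, rule ccontr)
      fix c j assume c: "\<forall>i\<in>{..<m}. (\<Sum>j\<in>X. c j * f j $ i) = 0"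
        and j: "j \<in> X" and nz: "c j \<noteq> 0"
      let ?a = "\<lambda>v. c (the_inv_into X f v)"
      have "V.lincomb ?a (f ` X) = 0\<^sub>v m"
      proof (rule eq_vecI)
        fix i assume i: "i < dim_vec (0\<^sub>v m :: 'q vec)"
        then show "V.lincomb ?a (f ` X) $ i = 0\<^sub>v m $ i"
          using L c f by (simp add: V.lincomb_index sum.reindex the_inv_into_f_f)
      next
        show "dim_vec (V.lincomb ?a (f ` X)) = dim_vec (0\<^sub>v m :: 'q vec)"
          using V.lincomb_dim[of "f ` X" ?a] fin f by simp
      qed
      then have "V.lin_dep (f ` X)"
        unfolding V.lin_dep_def
        using fin j nz L by (intro exI[of _ "f ` X"] exI[of _ ?a] exI[of _ "f j"])
          (auto simp: the_inv_into_f_f class_ring_simps)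
      then show False using L by simp
    qed
  next
    assume R: "indep_fam {..<m} (\<lambda>j i. f j $ i) X"
    show "inj_on f X"
    proof (rule inj_onI, rule ccontr)
      fix j k assume jk: "j \<in> X" "k \<in> X" "f j = f k" "j \<noteq> k"
      \<comment> \<open>Two equal members of the family are annihilated by the coefficients 1 and
        -1, so independence forces injectivity.\<close>
      let ?c = "\<lambda>l. if l = j then 1 else if l = k then - 1 else 0 :: 'q"
      have "(\<Sum>l\<in>X. ?c l * f l $ i) = 0" if "i \<in> {..<m}" for i
      proof -
        have "(\<Sum>l\<in>X. ?c l * f l $ i) = (\<Sum>l\<in>{j,k}. ?c l * f l $ i)"
          using fin jk by (intro sum.mono_neutral_right) auto
        also have "\<dots> = 0" using jk by simp
        finally show ?thesis .
      qed
      from indep_famD[OF R this jk(1)] show False by simp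
    qed
    show "\<not> V.lin_dep (f ` X)"
    proof
      assume "V.lin_dep (f ` X)"
      then obtain A a v where A: "finite A" "A \<subseteq> f ` X" "V.lincomb a A = 0\<^sub>v m" "v \<in> A" "a v \<noteq> 0"
        unfolding V.lin_dep_def by (auto simp: class_ring_simps)
      let ?c = "\<lambda>j. if f j \<in> A then a (f j) else 0"
      have "(\<Sum>j\<in>X. ?c j * f j $ i) = 0" if i: "i \<in> {..<m}" for i
      proof -
        have "(\<Sum>j\<in>X. ?c j * f j $ i) = (\<Sum>w\<in>f ` X. (if w \<in> A then a w else 0) * w $ i)"
          using \<open>inj_on f X\<close> by (simp add: sum.reindex)
        also have "\<dots> = (\<Sum>w\<in>A. a w * w $ i)"
          using A fin by (intro sum.mono_neutral_cong_right) auto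
        also have "\<dots> = V.lincomb a A $ i"
          using i A f by (subst V.lincomb_index) auto
        finally show ?thesis using A i by simp
      qed
      from indep_famD[OF R this] A show False by (metis (mono_tags, lifting) imageE subsetD)
    qed
  qed
qed

lemma column_matroid_indep_iff:
  "X \<in> indeps (column_matroid A) \<longleftrightarrow>
     X \<subseteq> {..<dim_col A} \<and> indep_fam {..<dim_row A} (\<lambda>j i. A $$ (i, j)) X"
proof (cases "X \<subseteq> {..<dim_col A}")
  case True
  have "indep_fam {..<dim_row A} (\<lambda>j i. A $$ (i, j)) X
      \<longleftrightarrow> indep_fam {..<dim_row A} (\<lambda>j i. col A j $ i) X"
    using True by (intro indep_fam_cong) auto
  moreover have "col A ` X \<subseteq> carrier_vec (dim_row A)" by auto
  ultimately show ?thesis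
    using indep_fam_vec_iff[of "col A" X "dim_row A"] finite_subset[OF True] True
    by (simp add: column_matroid_def lessThan_atLeast0)
qed (auto simp: column_matroid_def lessThan_atLeast0)

section \<open>Coordinates relative to a maximal independent family\<close>

lemma indep_fam_insert_repr:
  assumes S: "indep_fam I x S" and fin: "finite S" and j: "j \<notin> S"
    and dep: "\<not> indep_fam I x (insert j S)"
  obtains d where "\<And>i. i \<in> I \<Longrightarrow> x j i = (\<Sum>k\<in>S. d k * x k i)"
proof -
  from dep obtain c l where c: "\<And>i. i \<in> I \<Longrightarrow> (\<Sum>k\<in>insert j S. c k * x k i) = 0"
    and l: "l \<in> insert j S" "c l \<noteq> 0"
    unfolding indep_fam_def by blast
  have c': "c j * x j i + (\<Sum>k\<in>S. c k * x k i) = 0" if "i \<in> I" for i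
    using c[OF that] fin j by simp
  \<comment> \<open>A dependency with coefficient 0 at \<open>j\<close> would already be one of
    \<open>S\<close>. Hence the relation can be solved for the column \<open>j\<close>.\<close>
  have cj: "c j \<noteq> 0"
  proof
    assume "c j = 0"
    with c' have "\<And>i. i \<in> I \<Longrightarrow> (\<Sum>k\<in>S. c k * x k i) = 0" by simp
    from indep_famD[OF S this] l \<open>c j = 0\<close> show False by auto
  qed
  show thesis
  proof (rule that[of "\<lambda>k. - c k / c j"])
    fix i assume "i \<in> I"
    from c'[OF this] have "c j * x j i = - (\<Sum>k\<in>S. c k * x k i)" by (simp add: eq_neg_iff_add_eq_0)
    then have "x j i = - (\<Sum>k\<in>S. c k * x k i) / c j" using cj by (simp add: field_simps)
    also have "\<dots> = (\<Sum>k\<in>S. - c k / c j * x k i)"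
      by (simp add: sum_divide_distrib sum_negf)
    finally show "x j i = (\<Sum>k\<in>S. - c k / c j * x k i)" .
  qed
qed

lemma max_indep_fam_repr:
  assumes S: "indep_fam I x S" "S \<subseteq> X" and fin: "finite X"
    and max: "\<And>Y. Y \<subseteq> X \<Longrightarrow> indep_fam I x Y \<Longrightarrow> card Y \<le> card S"
  obtains d where "\<And>i j. i \<in> I \<Longrightarrow> j \<in> X \<Longrightarrow> x j i = (\<Sum>k\<in>S. d j k * x k i)"
proof -
  have finS: "finite S" using S fin finite_subset by blast
  have "\<exists>d. \<forall>i\<in>I. x j i = (\<Sum>k\<in>S. d k * x k i)" if j: "j \<in> X" for j
  proof (cases "j \<in> S")
    case True
    have "(\<Sum>k\<in>S. (if k = j then 1 else 0) * x k i) = (\<Sum>k\<in>S. if k = j then x k i else 0)" for i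
      by (rule sum.cong) auto
    then show ?thesis
      using True finS by (intro exI[of _ "\<lambda>k. if k = j then 1 else 0"]) simp
  next
    case False
    have "\<not> indep_fam I x (insert j S)"
      using max[of "insert j S"] j S(2) False finS by auto
    from indep_fam_insert_repr[OF S(1) finS False this] show ?thesis by metis
  qed
  then show thesis using that by metis
qed

text \<open>A linear combination of the \<open>x j\<close> has coordinates
  \<open>\<Sum>j\<in>X. c j * d j k\<close> in the independent family \<open>S\<close>, so it
  vanishes exactly when these do. Replacing columns by their coordinates thus preserves all
  dependencies while reducing the rows to \<open>card S\<close> many.\<close>

lemma indep_fam_coordinates:
  assumes S: "indep_fam I x S" and fin: "finite S"
    and d: "\<And>i j. i \<in> I \<Longrightarrow> j \<in> X \<Longrightarrow> x j i = (\<Sum>k\<in>S. d j k * x k i)"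
  shows "indep_fam I x X \<longleftrightarrow> indep_fam S d X"
proof -
  have "(\<forall>i\<in>I. (\<Sum>j\<in>X. c j * x j i) = 0) \<longleftrightarrow> (\<forall>k\<in>S. (\<Sum>j\<in>X. c j * d j k) = 0)" for c
  proof -
    have eq: "(\<Sum>j\<in>X. c j * x j i) = (\<Sum>k\<in>S. (\<Sum>j\<in>X. c j * d j k) * x k i)" if "i \<in> I" for i
    proof -
      have "(\<Sum>j\<in>X. c j * x j i) = (\<Sum>j\<in>X. \<Sum>k\<in>S. c j * d j k * x k i)"
        using d[OF that] by (intro sum.cong) (simp_all add: sum_distrib_left mult.assoc)
      also have "\<dots> = (\<Sum>k\<in>S. (\<Sum>j\<in>X. c j * d j k) * x k i)"
        by (subst sum.swap) (simp add: sum_distrib_right)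
      finally show ?thesis .
    qed
    show ?thesis
    proof
      assume "\<forall>i\<in>I. (\<Sum>j\<in>X. c j * x j i) = 0"
      then have "\<And>i. i \<in> I \<Longrightarrow> (\<Sum>k\<in>S. (\<Sum>j\<in>X. c j * d j k) * x k i) = 0" using eq by simp
      from indep_famD[OF S this] show "\<forall>k\<in>S. (\<Sum>j\<in>X. c j * d j k) = 0" by simp
    qed (simp add: eq)
  qed
  then show ?thesis unfolding indep_fam_def by simp
qed

lemma indep_fam_image_rows:
  "indep_fam (h ` I) x X \<longleftrightarrow> indep_fam I (\<lambda>j i. x j (h i)) X"
  unfolding indep_fam_def by simp

section \<open>Representations with as many rows as the rank\<close>

lemma matroid_iso_rank:
  assumes iso: "matroid_iso M N" and M: "indeps M \<subseteq> Pow (ground M)" and N: "indeps N \<subseteq> Pow (ground N)"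
  shows "matroid_rank M = matroid_rank N"
proof -
  from iso obtain f where f: "bij_betw f (ground M) (ground N)"
    and ff: "\<And>X. X \<subseteq> ground M \<Longrightarrow> X \<in> indeps M \<longleftrightarrow> f ` X \<in> indeps N"
    unfolding matroid_iso_def by blast
  have inj: "inj_on f X" if "X \<subseteq> ground M" for X
    using f that by (meson bij_betw_def inj_on_subset)
  have "card ` indeps M = card ` indeps N"
  proof (intro equalityI image_subsetI)
    fix X assume "X \<in> indeps M"
    then have "X \<subseteq> ground M" "f ` X \<in> indeps N" using M ff by auto
    then show "card X \<in> card ` indeps N" using inj card_image by (metis imageI)
  next
    fix Y assume Y: "Y \<in> indeps N"
    then obtain X where "X \<subseteq> ground M" "f ` X = Y"
      using f N by (metis PowD bij_betw_def subset_iff subset_imageE)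
    then show "card Y \<in> card ` indeps M" using ff[of X] Y inj[of X] card_image by (metis imageI)
  qed
  then show ?thesis by (simp add: matroid_rank_def)
qed

lemma column_matroid_subset: "indeps (column_matroid A) \<subseteq> Pow (ground (column_matroid A))"
  by (auto simp: column_matroid_def)

text \<open>A given representing matrix may have more rows than the rank, but residues will have
  exactly \<open>r(M)\<close> coordinates. A largest independent set \<open>S\<close> of columns has
  \<open>r(M)\<close> members, and coordinates relative to it represent \<open>M\<close>;
  \<open>h\<close> numbers these coordinates.\<close>

lemma representable_coordinates:
  fixes M :: "'a set_system"
  assumes M: "matroid M" and rep: "representable TYPE('q::field) M"
  obtains f :: "'a \<Rightarrow> nat" and v :: "nat \<Rightarrow> nat \<Rightarrow> 'q::field"
  where "bij_betw f (ground M) {..<card (ground M)}"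
    and "\<And>X. X \<subseteq> ground M \<Longrightarrow> X \<in> indeps M \<longleftrightarrow> indep_fam {..<matroid_rank M} v (f ` X)"
proof -
  from rep obtain A :: "'q mat" where iso: "matroid_iso M (column_matroid A)"
    unfolding representable_def by blast
  then obtain f where f: "bij_betw f (ground M) {..<dim_col A}"
    and ff: "\<And>X. X \<subseteq> ground M \<Longrightarrow> X \<in> indeps M \<longleftrightarrow> f ` X \<in> indeps (column_matroid A)"
    unfolding matroid_iso_def by (auto simp: column_matroid_def lessThan_atLeast0)
  have e: "dim_col A = card (ground M)" using bij_betw_same_card[OF f] by simp
  let ?x = "\<lambda>j i. A $$ (i, j)" and ?I = "{..<dim_row A}" and ?r = "matroid_rank M"
  let ?N = "column_matroid A"
  have r: "?r = Max (card ` indeps ?N)"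
    using matroid_iso_rank[OF iso _ column_matroid_subset] M
    unfolding matroid_rank_def matroid_def by simp
  have fin: "finite (indeps ?N)"
    using column_matroid_subset by (rule finite_subset) (simp add: column_matroid_def)
  have ne: "indeps ?N \<noteq> {}"
    using column_matroid_indep_iff[of "{}" A] by (auto simp: indep_fam_def)
  obtain S where S: "S \<in> indeps ?N" "card S = ?r"
    using Max_in[of "card ` indeps ?N"] fin ne r by (metis (no_types) finite_imageI image_is_empty imageE)
  have max: "card Y \<le> card S" if "Y \<subseteq> {..<dim_col A}" "indep_fam ?I ?x Y" for Y
    using that S fin r by (simp add: column_matroid_indep_iff)
  have S': "S \<subseteq> {..<dim_col A}" "indep_fam ?I ?x S"
    using S by (simp_all add: column_matroid_indep_iff)
  have finS: "finite S" using S' finite_subset by blast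
  obtain d where d: "\<And>i j. i \<in> ?I \<Longrightarrow> j \<in> {..<dim_col A} \<Longrightarrow> ?x j i = (\<Sum>k\<in>S. d j k * ?x k i)"
    using max_indep_fam_repr[OF S'(2) S'(1) _ max] by auto
  obtain h where h: "bij_betw h {..<?r} S"
    using ex_bij_betw_nat_finite[OF finS] S(2) by (auto simp: lessThan_atLeast0)
  show thesis
  proof (rule that[of f "\<lambda>j i. d j (h i)"])
    show "bij_betw f (ground M) {..<card (ground M)}" using f e by simp
    fix X assume X: "X \<subseteq> ground M"
    then have fX: "f ` X \<subseteq> {..<dim_col A}" using f by (auto simp: bij_betw_def)
    have "X \<in> indeps M \<longleftrightarrow> indep_fam ?I ?x (f ` X)"
      using ff[OF X] fX by (simp add: column_matroid_indep_iff)
    also have "\<dots> \<longleftrightarrow> indep_fam S d (f ` X)"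
      using d fX by (intro indep_fam_coordinates S' finS) auto
    also have "\<dots> \<longleftrightarrow> indep_fam {..<?r} (\<lambda>j i. d j (h i)) (f ` X)"
      using h indep_fam_image_rows[of h "{..<?r}"] by (simp add: bij_betw_def)
    finally show "X \<in> indeps M \<longleftrightarrow> indep_fam {..<?r} (\<lambda>j i. d j (h i)) (f ` X)" .
  qed
qed

section \<open>Counting linear combinations over a finite field\<close>

lemma lincomb_inj_on:
  assumes "indep_fam I x X"
  shows "inj_on (\<lambda>c. restrict (\<lambda>i. \<Sum>j\<in>X. c j * x j i) I) (X \<rightarrow>\<^sub>E UNIV)"
proof (rule inj_onI)
  fix c c' assume c: "c \<in> X \<rightarrow>\<^sub>E UNIV" "c' \<in> X \<rightarrow>\<^sub>E UNIV"
    and eq: "restrict (\<lambda>i. \<Sum>j\<in>X. c j * x j i) I = restrict (\<lambda>i. \<Sum>j\<in>X. c' j * x j i) I"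
  have "(\<Sum>j\<in>X. (c j - c' j) * x j i) = 0" if "i \<in> I" for i
    using fun_cong[OF eq, of i] that by (simp add: left_diff_distrib sum_subtractf)
  from indep_famD[OF assms this] have "\<And>j. j \<in> X \<Longrightarrow> c j = c' j" by simp
  with c show "c = c'" by (rule PiE_ext)
qed

lemma card_field_gt_1: "1 < CARD('q::{field,finite})"
  using card_mono[of UNIV "{0, 1 :: 'q}"] by simp

text \<open>The dimension bound by counting: the \<open>q ^ card X\<close> linear combinations are
  distinct and lie among \<open>q ^ card I\<close> vectors.\<close>

lemma indep_fam_card_le:
  fixes x :: "'j \<Rightarrow> 'i \<Rightarrow> 'q::{field,finite}"
  assumes "indep_fam I x X" "finite I" "finite X"
  shows "card X \<le> card I"
proof -
  have "card (X \<rightarrow>\<^sub>E (UNIV :: 'q set)) \<le> card (I \<rightarrow>\<^sub>E (UNIV :: 'q set))"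
    by (rule card_inj_on_le[OF lincomb_inj_on[OF assms(1)]]) (auto intro: finite_PiE assms)
  then have "CARD('q) ^ card X \<le> CARD('q) ^ card I"
    using assms by (simp add: card_PiE)
  then show ?thesis by (rule power_le_imp_le_exp[OF card_field_gt_1])
qed

text \<open>If a maximal independent set of columns were too small, then its rows would be dependent,
  and a dependency of its rows annihilates all columns.\<close>
lemma full_row_rank_basis:
  fixes x :: "'j \<Rightarrow> 'i \<Rightarrow> 'q::{field,finite}"
  assumes fin: "finite I" "finite X"
    and full: "\<And>w i. i \<in> I \<Longrightarrow> w i \<noteq> 0 \<Longrightarrow> \<exists>j\<in>X. (\<Sum>i\<in>I. w i * x j i) \<noteq> 0"
  obtains T where "T \<subseteq> X" "indep_fam I x T" "card T = card I"
proof -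
  have "indep_fam I x {} \<and> {} \<subseteq> X" by (simp add: indep_fam_def)
  moreover have "\<forall>T. indep_fam I x T \<and> T \<subseteq> X \<longrightarrow> card T < Suc (card X)"
    using fin card_mono le_imp_less_Suc by blast
  ultimately obtain T where T: "indep_fam I x T" "T \<subseteq> X"
    and max: "\<And>Y. Y \<subseteq> X \<Longrightarrow> indep_fam I x Y \<Longrightarrow> card Y \<le> card T"
    using ex_has_greatest_nat[of "\<lambda>T. indep_fam I x T \<and> T \<subseteq> X" "{}" card "Suc (card X)"] by blast
  obtain d where d: "\<And>i j. i \<in> I \<Longrightarrow> j \<in> X \<Longrightarrow> x j i = (\<Sum>k\<in>T. d j k * x k i)"
    using max_indep_fam_repr[OF T fin(2) max] by blast
  have finT: "finite T" using T fin finite_subset by blast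
  have "indep_fam T (\<lambda>i j. x j i) I"
    unfolding indep_fam_def
  proof (intro allI impI ballI, rule ccontr)
    fix w i assume w: "\<forall>j\<in>T. (\<Sum>i\<in>I. w i * x j i) = 0" and i: "i \<in> I" "w i \<noteq> 0"
    from full[where w=w, OF i] obtain j where j: "j \<in> X" "(\<Sum>i\<in>I. w i * x j i) \<noteq> 0" by blast
    have "(\<Sum>i\<in>I. w i * x j i) = (\<Sum>i\<in>I. \<Sum>k\<in>T. d j k * (w i * x k i))"
      using d j by (intro sum.cong) (simp_all add: sum_distrib_left mult_ac)
    also have "\<dots> = (\<Sum>k\<in>T. d j k * (\<Sum>i\<in>I. w i * x k i))"
      by (subst sum.swap) (simp add: sum_distrib_left)
    also have "\<dots> = 0" using w by simp
    finally show False using j by simp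
  qed
  \<comment> \<open>Independent rows on \<open>T\<close> give \<open>card I \<le> card T\<close>;
    independent columns in \<open>T\<close> give the reverse.\<close>
  from indep_fam_card_le[OF this finT fin(1)] indep_fam_card_le[OF T(1) fin(1) finT]
  show thesis using T that by simp
qed

lemma card_coordinate_fiber:
  fixes x :: "'j \<Rightarrow> 'i \<Rightarrow> 'q::{field,finite}"
  assumes indep: "indep_fam I x T" and fin: "finite T"
    and h: "inj_on h {..<r}" "h ` {..<r} \<subseteq> T"
  shows "card {y \<in> I \<rightarrow>\<^sub>E UNIV. \<exists>a. (\<forall>i\<in>I. y i = (\<Sum>t\<in>T. a t * x t i)) \<and> (\<forall>k<r. a (h k) = w k)}
           = CARD('q) ^ (card T - r)"
proof -
  let ?D = "h ` {..<r}"
  let ?B = "\<lambda>t. if t \<in> ?D then {w (the_inv_into {..<r} h t)} else UNIV"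
  let ?\<Phi> = "\<lambda>c. restrict (\<lambda>i. \<Sum>t\<in>T. c t * x t i) I"
  let ?L = "{y \<in> I \<rightarrow>\<^sub>E UNIV. \<exists>a. (\<forall>i\<in>I. y i = (\<Sum>t\<in>T. a t * x t i)) \<and> (\<forall>k<r. a (h k) = w k)}"
  have "?L = ?\<Phi> ` (Pi\<^sub>E T ?B)"
  proof (intro equalityI subsetI)
    fix y assume "y \<in> ?L"
    then obtain a where y: "y \<in> I \<rightarrow>\<^sub>E UNIV" and a: "\<forall>i\<in>I. y i = (\<Sum>t\<in>T. a t * x t i)" "\<forall>k<r. a (h k) = w k"
      by blast
    have "y = ?\<Phi> (restrict a T)"
      using y a by (intro PiE_ext[of y I "\<lambda>_. UNIV"]) auto
    moreover have "restrict a T \<in> Pi\<^sub>E T ?B"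
      using a h by (auto simp: the_inv_into_f_f)
    ultimately show "y \<in> ?\<Phi> ` (Pi\<^sub>E T ?B)" by blast
  next
    fix y assume "y \<in> ?\<Phi> ` (Pi\<^sub>E T ?B)"
    then obtain c where c: "c \<in> Pi\<^sub>E T ?B" "y = ?\<Phi> c" by blast
    have "c (h k) = w k" if "k < r" for k
    proof -
      have T: "h k \<in> T" and D: "h k \<in> ?D" using h that by auto
      have "c (h k) \<in> {w (the_inv_into {..<r} h (h k))}"
        using PiE_mem[OF c(1) T] unfolding if_P[OF D] .
      then show ?thesis using h that by (simp add: the_inv_into_f_f)
    qed
    then have "\<forall>k<r. c (h k) = w k" by blast
    moreover have "y \<in> I \<rightarrow>\<^sub>E UNIV" "\<forall>i\<in>I. y i = (\<Sum>t\<in>T. c t * x t i)"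
      unfolding c(2) by simp_all
    ultimately show "y \<in> ?L" by blast
  qed
  moreover have "inj_on ?\<Phi> (Pi\<^sub>E T ?B)"
    by (rule inj_on_subset[OF lincomb_inj_on[OF indep]]) auto
  ultimately have "card ?L = card (Pi\<^sub>E T ?B)" by (simp add: card_image)
  also have "\<dots> = (\<Prod>t\<in>T. if t \<in> ?D then 1 else CARD('q))"
    unfolding card_PiE[OF fin] by (rule prod.cong) (simp_all only: if_distrib[of card] card.empty card_insert_disjoint finite.emptyI empty_iff not_False_eq_True One_nat_def)
  also have "\<dots> = CARD('q) ^ card (T \<inter> - ?D)"
    using fin by (subst prod.If_cases) (auto simp: Compl_eq)
  also have "card (T \<inter> - ?D) = card T - r"
    using fin h by (simp add: Diff_eq[symmetric] card_Diff_subset card_image)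
  finally show ?thesis .
qed

text \<open>Contracting \<open>B\<close> amounts to forgetting the coordinates in \<open>B\<close>:
  the coefficients on \<open>B\<close> can always be chosen to cancel those coordinates, so only the
  coordinates on \<open>T - B\<close> constrain the coefficients on \<open>Y\<close>.\<close>

lemma indep_fam_contract:
  assumes indep: "indep_fam I x T" and fin: "finite T" "finite Y" and B: "B \<subseteq> T" and disj: "Y \<inter> T = {}"
    and d: "\<And>i j. i \<in> I \<Longrightarrow> j \<in> Y \<Longrightarrow> x j i = (\<Sum>k\<in>T. d j k * x k i)"
  shows "indep_fam I x (Y \<union> B) \<longleftrightarrow> indep_fam (T - B) d Y"
proof -
  have finB: "finite B" using B fin finite_subset by blast
  have YB: "Y \<inter> B = {}" using B disj by blast
  have eq: "(\<Sum>j\<in>Y \<union> B. c j * x j i)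
      = (\<Sum>k\<in>T. ((\<Sum>j\<in>Y. c j * d j k) + (if k \<in> B then c k else 0)) * x k i)" if "i \<in> I" for c i
  proof -
    have "(\<Sum>j\<in>Y. c j * x j i) = (\<Sum>j\<in>Y. \<Sum>k\<in>T. c j * d j k * x k i)"
      using d[OF that] by (intro sum.cong) (simp_all add: sum_distrib_left mult.assoc)
    also have "\<dots> = (\<Sum>k\<in>T. (\<Sum>j\<in>Y. c j * d j k) * x k i)"
      by (subst sum.swap) (simp add: sum_distrib_right)
    finally have 1: "(\<Sum>j\<in>Y. c j * x j i) = (\<Sum>k\<in>T. (\<Sum>j\<in>Y. c j * d j k) * x k i)" .
    have 2: "(\<Sum>j\<in>B. c j * x j i) = (\<Sum>k\<in>T. (if k \<in> B then c k else 0) * x k i)"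
      using B fin by (intro sum.mono_neutral_cong_left) auto
    show ?thesis
      using 1 2 fin finB YB by (simp add: sum.union_disjoint distrib_right sum.distrib)
  qed
  show ?thesis
  proof
    assume L: "indep_fam I x (Y \<union> B)"
    show "indep_fam (T - B) d Y"
      unfolding indep_fam_def
    proof (intro allI impI ballI)
      fix c j assume c: "\<forall>k\<in>T - B. (\<Sum>j\<in>Y. c j * d j k) = 0" and j: "j \<in> Y"
      \<comment> \<open>On \<open>B\<close> the coefficients are chosen to cancel the
        \<open>B\<close>-coordinates of the combination over \<open>Y\<close>.\<close>
      let ?c = "\<lambda>k. if k \<in> Y then c k else - (\<Sum>j\<in>Y. c j * d j k)"
      have "(\<Sum>j\<in>Y \<union> B. ?c j * x j i) = 0" if i: "i \<in> I" for i
        unfolding eq[OF i]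
      proof (intro sum.neutral ballI)
        fix k assume k: "k \<in> T"
        then have "k \<notin> Y" using disj by blast
        then show "((\<Sum>j\<in>Y. ?c j * d j k) + (if k \<in> B then ?c k else 0)) * x k i = 0"
          using c k by simp
      qed
      from indep_famD[OF L this, of j] j show "c j = 0" by simp
    qed
  next
    assume R: "indep_fam (T - B) d Y"
    show "indep_fam I x (Y \<union> B)"
      unfolding indep_fam_def
    proof (intro allI impI ballI)
      fix c j assume c: "\<forall>i\<in>I. (\<Sum>j\<in>Y \<union> B. c j * x j i) = 0" and j: "j \<in> Y \<union> B"
      \<comment> \<open>All coordinates relative to \<open>T\<close> vanish. Those outside
        \<open>B\<close> force \<open>c\<close> to be 0 on \<open>Y\<close>, and then those in
        \<open>B\<close> force it to be 0 on \<open>B\<close>.\<close>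
      have z: "(\<Sum>j\<in>Y. c j * d j k) + (if k \<in> B then c k else 0) = 0" if k: "k \<in> T" for k
        by (rule indep_famD[OF indep _ k]) (use c eq in simp)
      have "(\<Sum>j\<in>Y. c j * d j k) = 0" if "k \<in> T - B" for k
        using z[of k] that by simp
      from indep_famD[OF R this] have cY: "\<And>j. j \<in> Y \<Longrightarrow> c j = 0" by blast
      show "c j = 0"
      proof (cases "j \<in> Y")
        case False
        then have "j \<in> B" using j by blast
        with z[of j] B cY show ?thesis by auto
      qed (simp add: cY)
    qed
  qed
qed

section \<open>Minors of column matroids\<close>

lemma basis_of_indep:
  assumes "B \<in> indeps M"
  shows "basis_of M B B' \<longleftrightarrow> B' = B"
  using assms by (auto simp: basis_of_def)

text \<open>The deterministic half of the argument. Of the independent columns \<open>T\<close>, all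
  but the \<open>r\<close> columns \<open>D\<close> are contracted; the residue of the column
  \<open>c j\<close> is then its coordinate vector on \<open>D\<close>, which is \<open>v j\<close>.
  The contracted set is independent, hence its own only basis, so independence in the minor is
  independence together with \<open>B\<close>.\<close>

lemma is_minor_of_column_matroid:
  fixes M :: "'a set_system" and A :: "'q::{field,finite} mat" and v :: "nat \<Rightarrow> nat \<Rightarrow> 'q"
  defines "x \<equiv> (\<lambda>j i. A $$ (i, j))"
  assumes f: "bij_betw f (ground M) {..<e}"
    and M: "\<And>X. X \<subseteq> ground M \<Longrightarrow> X \<in> indeps M \<longleftrightarrow> indep_fam {..<r} v (f ` X)"
    and T: "T \<subseteq> {..<dim_col A}" "indep_fam {..<dim_row A} x T"
    and h: "inj_on h {..<r}" "h ` {..<r} \<subseteq> T"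
    and c: "inj_on c {..<e}" "c ` {..<e} \<subseteq> {..<dim_col A} - T"
    and a: "\<And>j i. j < e \<Longrightarrow> i < dim_row A \<Longrightarrow> x (c j) i = (\<Sum>t\<in>T. a j t * x t i)"
    and av: "\<And>j k. j < e \<Longrightarrow> k < r \<Longrightarrow> a j (h k) = v j k"
  shows "is_minor_of M (column_matroid A)"
proof -
  define D where "D = h ` {..<r}"
  define B where "B = T - D"
  define C where "C = c ` {..<e}"
  let ?N = "column_matroid A" and ?E = "{..<dim_col A}" and ?I = "{..<dim_row A}"
  let ?N1 = "contraction ?N B"
  \<comment> \<open>The deleted set includes \<open>D\<close>, which only supplies coordinates and
    does not belong to the minor.\<close>
  let ?N2 = "deletion ?N1 (?E - B - C)"
  have finT: "finite T" using T finite_subset by blast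
  have BT: "B \<subseteq> T" and TB: "T - B = D" using h by (auto simp: B_def D_def)
  have gN: "ground ?N = ?E" by (simp add: column_matroid_def lessThan_atLeast0)
  have BN: "B \<in> indeps ?N"
    using indep_fam_mono[OF T(2) BT finT] BT T by (auto simp: column_matroid_indep_iff x_def)
  have g1: "ground ?N1 = ?E - B" by (simp add: contraction_def gN)
  have CE: "C \<subseteq> ?E - T" using c by (simp add: C_def)
  then have C: "?E - B - (?E - B - C) = C" using BT by blast
  have g2: "ground ?N2 = C" by (simp add: deletion_def g1 C)
  have "reduces_to ?N ?N1"
    using T BT gN by (intro reduces_to.contract reduces_to.start) auto
  then have red: "reduces_to ?N ?N2"
    by (rule reduces_to.delete) (auto simp: g1)
  have i2: "Y \<in> indeps ?N2 \<longleftrightarrow> indep_fam ?I x (Y \<union> B)" if Y: "Y \<subseteq> C" for Y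
  proof -
    have "Y \<in> indeps ?N2 \<longleftrightarrow> Y \<union> B \<in> indeps ?N"
      using Y CE BT by (auto simp: deletion_def contraction_def basis_of_indep[OF BN] gN)
    also have "\<dots> \<longleftrightarrow> indep_fam ?I x (Y \<union> B)"
      using Y CE BT T by (auto simp: column_matroid_indep_iff x_def)
    finally show ?thesis .
  qed
  have key: "indep_fam ?I x (c ` X \<union> B) \<longleftrightarrow> indep_fam {..<r} v X" if X: "X \<subseteq> {..<e}" for X
  proof -
    let ?d = "\<lambda>k. a (the_inv_into {..<e} c k)"
    have inv: "the_inv_into {..<e} c (c j) = j" if "j \<in> X" for j
      using X that c by (intro the_inv_into_f_f) auto
    have "finite X" using X finite_subset by blast
    then have "indep_fam ?I x (c ` X \<union> B) \<longleftrightarrow> indep_fam D ?d (c ` X)"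
      unfolding TB[symmetric] using X c inv a
      by (intro indep_fam_contract[OF T(2) finT _ BT]) auto
    also have "\<dots> \<longleftrightarrow> indep_fam {..<r} (\<lambda>j k. ?d (c j) (h k)) X"
      using inj_on_subset[OF c(1) X] by (simp add: indep_fam_image_cols D_def indep_fam_image_rows)
    also have "\<dots> \<longleftrightarrow> indep_fam {..<r} v X"
      using X inv av by (intro indep_fam_cong) auto
    finally show ?thesis .
  qed
  have "matroid_iso M ?N2"
    unfolding matroid_iso_def
  proof (intro exI[of _ "c \<circ> f"] conjI allI impI)
    show "bij_betw (c \<circ> f) (ground M) (ground ?N2)"
      unfolding g2 using bij_betw_trans[OF f inj_on_imp_bij_betw[OF c(1)]] by (simp add: C_def)
    fix X assume X: "X \<subseteq> ground M"
    then have fX: "f ` X \<subseteq> {..<e}" using f by (auto simp: bij_betw_def)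
    then have "c ` f ` X \<subseteq> C" by (auto simp: C_def)
    from M[OF X] i2[OF this] key[OF fX]
    show "X \<in> indeps M \<longleftrightarrow> (c \<circ> f) ` X \<in> indeps ?N2" by (simp add: image_comp)
  qed
  with red show ?thesis unfolding is_minor_of_def by blast
qed

section \<open>Counting matrices by their columns\<close>

text \<open>Conditioning on the first \<open>s\<close> columns \<open>g\<close>: the set to be
  avoided may vary with \<open>g\<close>, but its size \<open>w\<close> does not, so every
  admissible \<open>g\<close> has the same number of extensions.\<close>

lemma card_PiE_avoid:
  fixes W :: "(nat \<Rightarrow> 'b) \<Rightarrow> 'b set"
  assumes fin: "finite V" and s: "s \<le> n" and K: "K \<subseteq> {s..<n}"
    and W: "\<And>g. g \<in> {..<s} \<rightarrow>\<^sub>E V \<Longrightarrow> G g \<Longrightarrow> W g \<subseteq> V \<and> card (W g) = w"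
  shows "card {f \<in> {..<n} \<rightarrow>\<^sub>E V. G (restrict f {..<s}) \<and> (\<forall>k\<in>K. f k \<notin> W (restrict f {..<s}))}
           \<le> card V ^ s * ((card V - w) ^ card K * card V ^ (n - s - card K))"
proof -
  let ?X = "{f \<in> {..<n} \<rightarrow>\<^sub>E V. G (restrict f {..<s}) \<and> (\<forall>k\<in>K. f k \<notin> W (restrict f {..<s}))}"
  let ?Gs = "{g \<in> {..<s} \<rightarrow>\<^sub>E V. G g}"
  \<comment> \<open>The singletons pin the first \<open>s\<close> columns to \<open>g\<close>, so
    the extensions of each \<open>g\<close> form a product set.\<close>
  let ?B = "\<lambda>g j. if j < s then {g j} else if j \<in> K then V - W g else V"
  let ?b = "(card V - w) ^ card K * card V ^ (n - s - card K)"
  have finG: "finite ?Gs" using fin by (simp add: finite_PiE)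
  have sub: "?X \<subseteq> (\<Union>g\<in>?Gs. Pi\<^sub>E {..<n} (?B g))"
  proof
    fix f assume f: "f \<in> ?X"
    let ?g = "restrict f {..<s}"
    have "?g \<in> ?Gs" using f s by (auto simp: PiE_iff)
    moreover have "f \<in> Pi\<^sub>E {..<n} (?B ?g)" using f by (auto simp: PiE_iff)
    ultimately show "f \<in> (\<Union>g\<in>?Gs. Pi\<^sub>E {..<n} (?B g))" by blast
  qed
  have c: "card (Pi\<^sub>E {..<n} (?B g)) = ?b" if g: "g \<in> ?Gs" for g
  proof -
    have Wg: "card (V - W g) = card V - w"
      using W[of g] g fin card_Diff_subset[of "W g" V] finite_subset[of "W g" V] by simp
    have "card (Pi\<^sub>E {..<n} (?B g)) = (\<Prod>j<n. if j < s then 1 else if j \<in> K then card V - w else card V)"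
      by (simp add: card_PiE, intro prod.cong) (simp_all add: Wg)
    also have "\<dots> = (\<Prod>j\<in>{s..<n}. if j \<in> K then card V - w else card V)"
      using s by (intro prod.mono_neutral_cong_right) auto
    also have "\<dots> = (card V - w) ^ card ({s..<n} \<inter> K) * card V ^ card ({s..<n} \<inter> - K)"
      by (subst prod.If_cases) simp_all
    also have "{s..<n} \<inter> K = K" using K by blast
    also have "card ({s..<n} \<inter> - K) = n - s - card K"
      using K by (simp add: Diff_eq[symmetric] card_Diff_subset finite_subset)
    finally show ?thesis .
  qed
  have "card ?Gs \<le> card ({..<s} \<rightarrow>\<^sub>E V)"
    using fin by (intro card_mono finite_PiE) auto
  then have cG: "card ?Gs \<le> card V ^ s" by (simp add: card_PiE)
  have "card ?X \<le> card (\<Union>g\<in>?Gs. Pi\<^sub>E {..<n} (?B g))"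
    using fin finG by (intro card_mono[OF _ sub] finite_UN_I finite_PiE)
      (auto intro: finite_subset[of "W _"])
  also have "\<dots> \<le> (\<Sum>g\<in>?Gs. card (Pi\<^sub>E {..<n} (?B g)))" by (rule card_UN_le[OF finG])
  also have "\<dots> = card ?Gs * ?b" using c by simp
  also have "\<dots> \<le> card V ^ s * ?b" using cG by (intro mult_right_mono) simp_all
  finally show ?thesis .
qed

text \<open>Translating the kernel along a coordinate \<open>k\<close> with
  \<open>w k \<noteq> 0\<close> gives \<open>q\<close> disjoint copies, so a nonzero functional
  vanishes on at most a fraction \<open>1/q\<close> of all vectors.\<close>

lemma card_kernel_functional:
  fixes w :: "'i \<Rightarrow> 'q::{field,finite}"
  assumes fin: "finite I" and k: "k \<in> I" "w k \<noteq> 0"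
  shows "CARD('q) * card {y \<in> I \<rightarrow>\<^sub>E UNIV. (\<Sum>i\<in>I. w i * y i) = 0} \<le> CARD('q) ^ card I"
proof -
  let ?H = "{y \<in> I \<rightarrow>\<^sub>E UNIV. (\<Sum>i\<in>I. w i * y i) = 0}"
  let ?f = "\<lambda>(a, y). y(k := y k + a)"
  have sum: "(\<Sum>i\<in>I. w i * (y(k := y k + a)) i) = (\<Sum>i\<in>I. w i * y i) + w k * a" for y a
    using fin k by (simp add: sum.remove[of I k] distrib_left cong: sum.cong_simp)
  have "inj_on ?f (UNIV \<times> ?H)"
  proof (rule inj_onI, clarify)
    fix a b y z
    assume y: "(\<Sum>i\<in>I. w i * y i) = 0" and z: "(\<Sum>i\<in>I. w i * z i) = 0"
      and eq: "y(k := y k + a) = z(k := z k + b)"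
    have "w k * a = w k * b" using sum[of y a] sum[of z b] y z eq by simp
    then have ab: "a = b" using k by simp
    moreover have "y i = z i" for i
      using fun_cong[OF eq, of i] ab by (cases "i = k") auto
    ultimately show "a = b \<and> y = z" by auto
  qed
  then have "card ((UNIV :: 'q set) \<times> ?H) \<le> card (I \<rightarrow>\<^sub>E (UNIV :: 'q set))"
    by (rule card_inj_on_le) (use k fin in \<open>auto intro!: finite_PiE simp: PiE_iff extensional_def\<close>)
  then show ?thesis using fin by (simp add: card_cartesian_product card_PiE)
qed

text \<open>Union bound: there are at most \<open>q ^ m\<close> nonzero row vectors, and each
  annihilates \<open>s\<close> given columns with probability at most \<open>q ^ (-s)\<close>.
  Multiplying by \<open>q ^ s\<close> keeps the count in the natural numbers.\<close>

lemma card_rank_deficient: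
  fixes m n s :: nat
  defines "V \<equiv> {..<m} \<rightarrow>\<^sub>E (UNIV :: 'q::{field,finite} set)"
  assumes s: "s \<le> n"
  shows "CARD('q) ^ s * card {f \<in> {..<n} \<rightarrow>\<^sub>E V. \<exists>w. (\<exists>i<m. w i \<noteq> 0) \<and> (\<forall>j<s. (\<Sum>i<m. w i * f j i) = 0)}
           \<le> CARD('q) ^ m * card V ^ n"
proof -
  let ?X = "{f \<in> {..<n} \<rightarrow>\<^sub>E V. \<exists>w. (\<exists>i<m. w i \<noteq> 0) \<and> (\<forall>j<s. (\<Sum>i<m. w i * f j i) = 0)}"
  let ?Ws = "{w \<in> V. \<exists>i<m. w i \<noteq> 0}"
  let ?H = "\<lambda>w. {y \<in> V. (\<Sum>i<m. w i * y i) = 0}"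
  let ?B = "\<lambda>w j. if j < s then ?H w else V"
  have finV: "finite V" unfolding V_def by (intro finite_PiE) auto
  have cV: "card V = CARD('q) ^ m" by (simp add: V_def card_PiE)
  have sub: "?X \<subseteq> (\<Union>w\<in>?Ws. Pi\<^sub>E {..<n} (?B w))"
  proof
    fix f assume "f \<in> ?X"
    then obtain w where f: "f \<in> {..<n} \<rightarrow>\<^sub>E V"
      and w: "\<exists>i<m. w i \<noteq> 0" "\<forall>j<s. (\<Sum>i<m. w i * f j i) = 0" by blast
    \<comment> \<open>Only the values of \<open>w\<close> below \<open>m\<close> matter; restricting
      it makes the union range over a finite set.\<close>
    let ?w = "restrict w {..<m}"
    have "?w \<in> ?Ws" using w(1) by (auto simp: V_def)
    moreover have "f \<in> Pi\<^sub>E {..<n} (?B ?w)" using f w(2) by (auto simp: PiE_iff)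
    ultimately show "f \<in> (\<Union>w\<in>?Ws. Pi\<^sub>E {..<n} (?B w))" by blast
  qed
  have c: "CARD('q) ^ s * card (Pi\<^sub>E {..<n} (?B w)) \<le> card V ^ n" if w: "w \<in> ?Ws" for w
  proof -
    have "card (Pi\<^sub>E {..<n} (?B w)) = (\<Prod>j<n. if j \<in> {..<s} then card (?H w) else card V)"
      by (simp add: card_PiE, intro prod.cong) simp_all
    also have "\<dots> = card (?H w) ^ card ({..<n} \<inter> {..<s}) * card V ^ card ({..<n} \<inter> - {..<s})"
      by (subst prod.If_cases) (simp_all only: Collect_mem_eq prod_constant finite_lessThan)
    also have "{..<n} \<inter> {..<s} = {..<s}" using s by auto
    also have "{..<n} \<inter> - {..<s} = {s..<n}" by auto
    finally have "CARD('q) ^ s * card (Pi\<^sub>E {..<n} (?B w)) = (CARD('q) * card (?H w)) ^ s * card V ^ (n - s)"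
      by (simp add: power_mult_distrib)
    also have "\<dots> \<le> card V ^ s * card V ^ (n - s)"
      using w card_kernel_functional[of "{..<m}" _ w]
      by (intro mult_right_mono power_mono) (auto simp: cV, auto simp: V_def)
    also have "\<dots> = card V ^ n" using s by (simp flip: power_add)
    finally show ?thesis .
  qed
  have finW: "finite ?Ws" using finV by simp
  have "card ?X \<le> card (\<Union>w\<in>?Ws. Pi\<^sub>E {..<n} (?B w))"
    using finV finW by (intro card_mono[OF _ sub] finite_UN_I finite_PiE) auto
  also have "\<dots> \<le> (\<Sum>w\<in>?Ws. card (Pi\<^sub>E {..<n} (?B w)))" by (rule card_UN_le[OF finW])
  finally have "CARD('q) ^ s * card ?X \<le> (\<Sum>w\<in>?Ws. CARD('q) ^ s * card (Pi\<^sub>E {..<n} (?B w)))"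
    by (simp flip: sum_distrib_left)
  also have "\<dots> \<le> card ?Ws * card V ^ n" using sum_bounded_above[of ?Ws, OF c] by simp
  also have "\<dots> \<le> card V * card V ^ n" using finV by (intro mult_right_mono card_mono) auto
  finally show ?thesis by (simp add: cV)
qed

section \<open>From matrices to families of columns\<close>

lemma bij_betw_columns_carrier_mat:
  "bij_betw (\<lambda>f. mat m n (\<lambda>(i, j). f j i)) ({..<n} \<rightarrow>\<^sub>E ({..<m} \<rightarrow>\<^sub>E (UNIV :: 'a set))) (carrier_mat m n)"
proof (rule bij_betw_byWitness[where f' = "\<lambda>A. \<lambda>j\<in>{..<n}. \<lambda>i\<in>{..<m}. A $$ (i, j)"])
  show "\<forall>f\<in>{..<n} \<rightarrow>\<^sub>E ({..<m} \<rightarrow>\<^sub>E (UNIV :: 'a set)).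
      (\<lambda>j\<in>{..<n}. \<lambda>i\<in>{..<m}. mat m n (\<lambda>(i, j). f j i) $$ (i, j)) = f"
  proof
    fix f :: "nat \<Rightarrow> nat \<Rightarrow> 'a" assume f: "f \<in> {..<n} \<rightarrow>\<^sub>E ({..<m} \<rightarrow>\<^sub>E UNIV)"
    show "(\<lambda>j\<in>{..<n}. \<lambda>i\<in>{..<m}. mat m n (\<lambda>(i, j). f j i) $$ (i, j)) = f"
    proof (intro ext)
      fix j i
      show "(\<lambda>j\<in>{..<n}. \<lambda>i\<in>{..<m}. mat m n (\<lambda>(i, j). f j i) $$ (i, j)) j i = f j i"
        using f by (cases "j < n"; cases "i < m") (auto simp: PiE_iff extensional_def)
    qed
  qed
qed (auto split: if_splits)

text \<open>A matrix is identified with its family of columns, whence the index order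
  \<open>f j i\<close>; probabilities become counts in a product of \<open>n\<close> copies of the
  column space.\<close>

lemma prob_uniform_mat:
  fixes S :: "'q::{field,finite} mat set"
  shows "measure_pmf.prob (uniform_mat m n) S =
    real (card {f \<in> {..<n} \<rightarrow>\<^sub>E ({..<m} \<rightarrow>\<^sub>E UNIV). mat m n (\<lambda>(i, j). f j i) \<in> S})
      / real (CARD('q) ^ m) ^ n"
proof -
  let ?F = "{..<n} \<rightarrow>\<^sub>E ({..<m} \<rightarrow>\<^sub>E (UNIV :: 'q set))"
  let ?\<phi> = "\<lambda>f. mat m n (\<lambda>(i, j). f j i) :: 'q mat"
  have bij: "bij_betw ?\<phi> ?F (carrier_mat m n)" by (rule bij_betw_columns_carrier_mat)
  have "bij_betw ?\<phi> {f \<in> ?F. ?\<phi> f \<in> S} (carrier_mat m n \<inter> S)"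
    by (rule bij_betw_subset[OF bij]) (use bij in \<open>auto simp: bij_betw_def\<close>)
  then have "card (carrier_mat m n \<inter> S) = card {f \<in> ?F. ?\<phi> f \<in> S}"
    by (simp add: bij_betw_same_card)
  moreover have "card (carrier_mat m n :: 'q mat set) = (CARD('q) ^ m) ^ n"
    using bij_betw_same_card[OF bij] by (simp add: card_PiE)
  ultimately show ?thesis
    unfolding uniform_mat_def
    by (simp add: measure_pmf_of_set finite_carrier_mat carrier_mat_nonempty)
qed

section \<open>The probability of containing a minor\<close>

text \<open>The first \<open>s\<close> columns are asked to span; they provide a basis \<open>T\<close>, of which all but \<open>r\<close> members
  are contracted. The remaining columns are cut into \<open>e\<close> blocks of length \<open>L\<close>, and the \<open>j\<close>-th block
  is asked to contain a column whose residue is the \<open>j\<close>-th column of a representation of \<open>M\<close>.\<close>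
lemma prob_minor_ge:
  fixes M :: "'a set_system" and v :: "nat \<Rightarrow> nat \<Rightarrow> 'q::{field,finite}"
  assumes f: "bij_betw f (ground M) {..<e}"
    and M: "\<And>X. X \<subseteq> ground M \<Longrightarrow> X \<in> indeps M \<longleftrightarrow> indep_fam {..<r} v (f ` X)"
    and r: "r \<le> m" and n: "m + L + e * L \<le> n"
  shows "1 - ((1 / real CARD('q)) ^ L + real e * (1 - (1 / real CARD('q)) ^ r) ^ L)
    \<le> measure_pmf.prob (uniform_mat m n :: 'q mat pmf) {A. is_minor_of M (column_matroid A)}"
proof -
  \<comment> \<open>The last \<open>e * L\<close> columns are reserved for the blocks. At least
    \<open>m + L\<close> remain in front, and the surplus \<open>L\<close> over \<open>m\<close>
    yields the failure bound \<open>q ^ (-L)\<close>.\<close>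
  define s where "s = n - e * L"
  define V where "V = {..<m} \<rightarrow>\<^sub>E (UNIV :: 'q set)"
  let ?q = "CARD('q)"
  let ?I = "{..<m}" and ?F = "{..<n} \<rightarrow>\<^sub>E V"
  let ?\<phi> = "\<lambda>f. mat m n (\<lambda>(i, j). f j i) :: 'q mat"
  let ?S = "{A :: 'q mat. is_minor_of M (column_matroid A)}"
  \<comment> \<open>\<open>G\<close> says that the first \<open>s\<close> columns have full row rank
    \<open>m\<close>, in the dual form suited to the union bound.\<close>
  define G :: "(nat \<Rightarrow> nat \<Rightarrow> 'q) \<Rightarrow> bool"
    where "G g \<longleftrightarrow> (\<forall>w. (\<exists>i<m. w i \<noteq> 0) \<longrightarrow> (\<exists>j<s. (\<Sum>i<m. w i * g j i) \<noteq> 0))" for g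
  have sn: "s \<le> n" "m + L \<le> s" "s + e * L = n" using n by (auto simp: s_def)
  have finV: "finite V" unfolding V_def by (intro finite_PiE) auto
  have cV: "card V = ?q ^ m" by (simp add: V_def card_PiE)
  have finF: "finite ?F" using finV by (intro finite_PiE) auto

  have "\<exists>T h. T \<subseteq> {..<s} \<and> indep_fam ?I g T \<and> card T = m \<and> inj_on h {..<r} \<and> h ` {..<r} \<subseteq> T"
    if G: "G g" for g
  proof -
    obtain T where T: "T \<subseteq> {..<s}" "indep_fam ?I g T" "card T = card ?I"
      using full_row_rank_basis[of ?I "{..<s}" g] G unfolding G_def
      by (metis finite_lessThan lessThan_iff)
    then have "finite T" using finite_subset by blast
    then obtain h where "inj_on h {..<r}" "h ` {..<r} \<subseteq> T"
      using card_le_inj[of "{..<r}" T] T(3) r by auto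
    with T show ?thesis by auto
  qed
  \<comment> \<open>The basis and its \<open>r\<close> uncontracted members are chosen as functions
    of the initial columns alone, so that the target sets depend on nothing else.\<close>
  then obtain T h where T: "\<And>g. G g \<Longrightarrow> T g \<subseteq> {..<s}" "\<And>g. G g \<Longrightarrow> indep_fam ?I g (T g)"
      "\<And>g. G g \<Longrightarrow> card (T g) = m"
    and h: "\<And>g. G g \<Longrightarrow> inj_on (h g) {..<r}" "\<And>g. G g \<Longrightarrow> h g ` {..<r} \<subseteq> T g"
    by metis

  \<comment> \<open>The columns whose residue is \<open>v j\<close>. When \<open>G g\<close> holds,
    \<open>T g\<close> is a basis of the column space, and \<open>W j g\<close> makes up a fraction
    \<open>q ^ (-r)\<close> of all columns.\<close>
  define W where "W j g = {y \<in> V. \<exists>a. (\<forall>i\<in>?I. y i = (\<Sum>t\<in>T g. a t * g t i)) \<and> (\<forall>k<r. a (h g k) = v j k)}"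
    for j g
  have W: "W j g \<subseteq> V \<and> card (W j g) = ?q ^ (m - r)" if "G g" for j g
    using card_coordinate_fiber[of ?I g "T g" "h g" r "v j"] T[OF that] h[OF that]
      finite_subset[OF T(1)[OF that]]
    by (auto simp: W_def V_def)

  \<comment> \<open>The blocks are disjoint and start at \<open>s\<close>, so the columns picked
    from them are distinct and lie outside \<open>T\<close>.\<close>
  let ?K = "\<lambda>j. {s + j * L..<s + Suc j * L}"
  define X0 where "X0 = {f \<in> ?F. \<exists>w. (\<exists>i<m. w i \<noteq> 0) \<and> (\<forall>j<s. (\<Sum>i<m. w i * f j i) = 0)}"
  define X where "X j = {f \<in> ?F. G (restrict f {..<s}) \<and> (\<forall>k\<in>?K j. f k \<notin> W j (restrict f {..<s}))}" for j

  have good: "?\<phi> x \<in> ?S" if x: "x \<in> ?F" and x0: "x \<notin> X0" and xj: "\<And>j. j < e \<Longrightarrow> x \<notin> X j" for x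
  proof -
    let ?g = "restrict x {..<s}"
    have "G x" using x x0 unfolding X0_def G_def by blast
    then have G: "G ?g" unfolding G_def by (simp cong: conj_cong)
    define P where "P j k a \<longleftrightarrow> k \<in> ?K j \<and> (\<forall>i\<in>?I. x k i = (\<Sum>t\<in>T ?g. a t * ?g t i))
      \<and> (\<forall>i<r. a (h ?g i) = v j i)" for j k a
    have "\<exists>k a. P j k a" if "j < e" for j
      using xj[OF that] x G unfolding X_def W_def P_def by blast
    then obtain c a where "\<And>j. j < e \<Longrightarrow> P j (c j) (a j)"
      by metis
    then have c: "\<And>j. j < e \<Longrightarrow> c j \<in> ?K j"
      and a: "\<And>j i. j < e \<Longrightarrow> i < m \<Longrightarrow> x (c j) i = (\<Sum>t\<in>T ?g. a j t * ?g t i)"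
      and av: "\<And>j i. j < e \<Longrightarrow> i < r \<Longrightarrow> a j (h ?g i) = v j i"
      unfolding P_def by blast+
    have cn: "s \<le> c j \<and> c j < n" if "j < e" for j
    proof -
      have "Suc j * L \<le> e * L" using that by (intro mult_right_mono) auto
      then show ?thesis using c[OF that] sn(3) by simp
    qed
    have "c j \<noteq> c k" if "j < k" "k < e" for j k
    proof -
      have "Suc j * L \<le> k * L" using that by (intro mult_right_mono) auto
      then show ?thesis using c[of j] c[of k] that by simp
    qed
    then have inj: "inj_on c {..<e}"
      by (intro inj_onI) (metis lessThan_iff linorder_neqE_nat)
    have Ts: "T ?g \<subseteq> {..<s}" by (rule T(1)[OF G])
    have Tx: "?\<phi> x $$ (i, t) = ?g t i" if "t \<in> T ?g" "i < m" for t i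
      using that Ts sn(1) by auto
    have "is_minor_of M (column_matroid (?\<phi> x))"
    proof (rule is_minor_of_column_matroid[OF f M _ _ h(1)[OF G] h(2)[OF G] inj])
      show "T ?g \<subseteq> {..<dim_col (?\<phi> x)}" using Ts sn(1) by auto
      have "indep_fam ?I (\<lambda>j i. ?\<phi> x $$ (i, j)) (T ?g) \<longleftrightarrow> indep_fam ?I ?g (T ?g)"
        by (rule indep_fam_cong) (simp add: Tx del: index_mat)
      then show "indep_fam {..<dim_row (?\<phi> x)} (\<lambda>j i. ?\<phi> x $$ (i, j)) (T ?g)"
        using T(2)[OF G] by simp
      show "c ` {..<e} \<subseteq> {..<dim_col (?\<phi> x)} - T ?g" using cn Ts by force
      fix j i assume "j < e" "i < dim_row (?\<phi> x)"
      then show "?\<phi> x $$ (i, c j) = (\<Sum>t\<in>T ?g. a j t * ?\<phi> x $$ (i, t))"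
        using a[of j i] cn[of j] Tx by (simp del: restrict_apply)
    qed (use av in auto)
    then show ?thesis by simp
  qed

  have real_q: "1 \<le> real ?q" using card_field_gt_1[where 'q='q] by simp
  have p0: "real (card X0) \<le> (1 / real ?q) ^ L * real (card V) ^ n"
  proof -
    have "?q ^ s * card X0 \<le> ?q ^ m * card V ^ n"
      unfolding X0_def V_def by (rule card_rank_deficient[OF sn(1)])
    then have "real (?q ^ s * card X0) \<le> real (?q ^ m * card V ^ n)" by (rule of_nat_mono)
    moreover have "real ?q ^ (m + L) * real (card X0) \<le> real ?q ^ s * real (card X0)"
      using real_q sn(2) by (intro mult_right_mono power_increasing) auto
    ultimately have "real ?q ^ m * (real ?q ^ L * real (card X0)) \<le> real ?q ^ m * real (card V) ^ n"
      by (simp only: power_add mult.assoc of_nat_mult of_nat_power)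
    then have "real ?q ^ L * real (card X0) \<le> real (card V) ^ n"
      by (rule mult_left_le_imp_le) (use real_q in simp)
    then show ?thesis using real_q by (simp add: power_one_over field_simps)
  qed
  have pj: "real (card (X j)) \<le> (1 - (1 / real ?q) ^ r) ^ L * real (card V) ^ n" if j: "j < e" for j
  proof -
    have "Suc j * L \<le> e * L" using j by (intro mult_right_mono) auto
    then have K: "?K j \<subseteq> {s..<n}" using sn(3) by auto
    have sL: "s + L \<le> n" using \<open>Suc j * L \<le> e * L\<close> sn(3) by simp
    have "card (X j) \<le> card V ^ s * ((card V - ?q ^ (m - r)) ^ card (?K j) * card V ^ (n - s - card (?K j)))"
      unfolding X_def using W by (intro card_PiE_avoid finV sn(1) K) blast
    then have "card (X j) \<le> card V ^ s * ((card V - ?q ^ (m - r)) ^ L * card V ^ (n - s - L))"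
      by simp
    then have "real (card (X j)) \<le> real (card V ^ s * ((card V - ?q ^ (m - r)) ^ L * card V ^ (n - s - L)))"
      by (rule of_nat_mono)
    also have "\<dots> = real (card V) ^ s * (real (card V - ?q ^ (m - r)) ^ L * real (card V) ^ (n - s - L))"
      by simp
    also have "real (card V - ?q ^ (m - r)) = (1 - (1 / real ?q) ^ r) * real (card V)"
    proof -
      have "?q ^ (m - r) \<le> ?q ^ m" using real_q by (intro power_increasing) auto
      moreover have "real ?q ^ m = real ?q ^ (m - r) * real ?q ^ r" using r by (simp flip: power_add)
      ultimately show ?thesis using real_q by (simp add: cV of_nat_diff power_one_over field_simps)
    qed
    also have "real (card V) ^ s * (((1 - (1 / real ?q) ^ r) * real (card V)) ^ L * real (card V) ^ (n - s - L))
        = (1 - (1 / real ?q) ^ r) ^ L * real (card V) ^ (s + (L + (n - s - L)))"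
      by (simp add: power_add power_mult_distrib)
    also have "s + (L + (n - s - L)) = n" using sL by simp
    finally show ?thesis .
  qed

  have "{x \<in> ?F. ?\<phi> x \<in> - ?S} \<subseteq> X0 \<union> (\<Union>j<e. X j)"
    using good by blast
  then have "card {x \<in> ?F. ?\<phi> x \<in> - ?S} \<le> card (X0 \<union> (\<Union>j<e. X j))"
    using finF by (intro card_mono) (auto simp: X0_def X_def)
  also have "\<dots> \<le> card X0 + (\<Sum>j<e. card (X j))"
    using card_Un_le card_UN_le[of "{..<e}" X] by (meson add_left_mono finite_lessThan order_trans)
  finally have "real (card {x \<in> ?F. ?\<phi> x \<in> - ?S}) \<le> real (card X0 + (\<Sum>j<e. card (X j)))"
    by (rule of_nat_mono)
  also have "\<dots> = real (card X0) + (\<Sum>j<e. real (card (X j)))"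
    by (simp only: of_nat_add of_nat_sum)
  also have "\<dots> \<le> (1 / real ?q) ^ L * real (card V) ^ n
      + real e * ((1 - (1 / real ?q) ^ r) ^ L * real (card V) ^ n)"
    using p0 sum_bounded_above[of "{..<e}" "\<lambda>j. real (card (X j))", OF pj] by (intro add_mono) auto
  finally have le: "real (card {x \<in> ?F. ?\<phi> x \<in> - ?S})
      \<le> ((1 / real ?q) ^ L + real e * (1 - (1 / real ?q) ^ r) ^ L) * real (card V) ^ n"
    by (simp add: algebra_simps)
  have pos: "0 < real (card V) ^ n" using real_q by (simp add: cV)
  have "measure_pmf.prob (uniform_mat m n) (- ?S) = real (card {x \<in> ?F. ?\<phi> x \<in> - ?S}) / real (card V) ^ n"
    unfolding prob_uniform_mat V_def[symmetric] cV by simp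
  also have "\<dots> \<le> (1 / real ?q) ^ L + real e * (1 - (1 / real ?q) ^ r) ^ L"
    using le pos by (simp add: pos_divide_le_eq)
  finally show ?thesis
    using measure_pmf.prob_compl[of ?S "uniform_mat m n"] by (simp add: Compl_eq_Diff_UNIV)
qed

theorem theorem8:
  fixes M :: "'a set_system"
    and m :: "nat \<Rightarrow> nat"
  assumes "matroid M"
    and "\<not> free_matroid M"
    and "representable TYPE('q::{field,finite}) M"
    and "eventually (\<lambda>n. matroid_rank M \<le> m n) sequentially"
    and "filterlim (\<lambda>n. int n - int (m n)) at_top sequentially"
  shows "(\<lambda>n. measure_pmf.prob (uniform_mat (m n) n :: 'q mat pmf)
             {A. is_minor_of M (column_matroid A)}) \<longlonglongrightarrow> 1"
proof -
  define e where "e = card (ground M)"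
  define r where "r = matroid_rank M"
  \<comment> \<open>The surplus \<open>n - m n\<close> is split into \<open>e + 1\<close> equal
    parts: one ensures spanning, the others are the \<open>e\<close> blocks.\<close>
  define L where "L n = (n - m n) div (e + 1)" for n
  let ?q = "CARD('q)"
  obtain f and v :: "nat \<Rightarrow> nat \<Rightarrow> 'q"
    where f: "bij_betw f (ground M) {..<e}"
      and v: "\<And>X. X \<subseteq> ground M \<Longrightarrow> X \<in> indeps M \<longleftrightarrow> indep_fam {..<r} v (f ` X)"
    using representable_coordinates[OF assms(1,3)] unfolding e_def r_def by blast
  have L: "filterlim L at_top sequentially"
    unfolding filterlim_at_top
  proof
    fix Z :: nat
    have "eventually (\<lambda>n. int (Z * (e + 1)) \<le> int n - int (m n)) sequentially"
      using assms(5) by (simp add: filterlim_at_top)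
    then show "eventually (\<lambda>n. Z \<le> L n) sequentially"
    proof eventually_elim
      case (elim n)
      then have "Z * (e + 1) \<le> n - m n" by linarith
      then show ?case unfolding L_def by (simp add: less_eq_div_iff_mult_less_eq)
    qed
  qed
  let ?\<epsilon> = "\<lambda>l. (1 / real ?q) ^ l + real e * (1 - (1 / real ?q) ^ r) ^ l"
  have q: "1 < real ?q" using card_field_gt_1[where 'q='q] by simp
  \<comment> \<open>These bounds put \<open>1 - (1 / real ?q) ^ r\<close> in the interval from 0
    inclusive to 1 exclusive, so its powers tend to 0.\<close>
  have "0 < (1 / real ?q) ^ r" "(1 / real ?q) ^ r \<le> 1"
    using q by (auto intro: power_le_one)
  then have "(\<lambda>l. 1 - ?\<epsilon> l) \<longlonglongrightarrow> 1 - (0 + real e * 0)"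
    using q by (intro tendsto_intros LIMSEQ_power_zero) (auto simp: abs_if)
  then have lim: "(\<lambda>n. 1 - ?\<epsilon> (L n)) \<longlonglongrightarrow> 1"
    using filterlim_compose[OF _ L, of "\<lambda>l. 1 - ?\<epsilon> l"] by simp
  \<comment> \<open>Eventually \<open>m n \<le> n\<close>, so the truncated subtraction in
    \<open>L\<close> is a true difference and the columns suffice for the bound.\<close>
  have "eventually (\<lambda>n. 0 \<le> int n - int (m n)) sequentially"
    using assms(5) unfolding filterlim_at_top by blast
  with assms(4) have low: "eventually (\<lambda>n. 1 - ?\<epsilon> (L n)
      \<le> measure_pmf.prob (uniform_mat (m n) n :: 'q mat pmf) {A. is_minor_of M (column_matroid A)}) sequentially"
  proof eventually_elim
    case (elim n)
    have "L n * (e + 1) \<le> n - m n" unfolding L_def by (rule div_times_less_eq_dividend)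
    then have "m n + L n + e * L n \<le> n" using elim by (simp add: algebra_simps)
    with elim show ?case by (intro prob_minor_ge[OF f v]) (auto simp: r_def)
  qed
  show ?thesis
    by (rule tendsto_sandwich[OF low _ lim tendsto_const]) simp
qed

end
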